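(* Let $H$ be a finite group and let $n\ge 2$ be an integer. Then every cyclic D-sequence in $H$ has a lift by $\mathbb{Z}_{2^n}$ that is a cyclic D-sequence in $H\times\mathbb{Z}_{2^n}$.
   Context: All groups are finite; $1_G$ denotes the identity of a group $G$; $\mathbb{Z}_k$ is the cyclic group of order $k$. For a sequence ${\bf g}: g_0,\ldots,g_l$ in a group $G$ with $g_0=1_G$, the sequence of consecutive quotients ${\bf \bar g}:\bar g_0,\ldots,\bar g_l$ is defined by $\bar g_0=1_G$ and $\bar g_i=g_{i-1}^{-1}g_i$ for $1\le i\le l$. A D-sequence in a finite group $G$ of order $m$ is a sequence ${\bf g}: g_0,\ldots,g_{2m-1}$ in $G$ with $g_0=1_G$ such that every element of $G$ appears exactly twice in each of ${\bf g}$ and ${\bf \bar g}$. A D-sequence is cyclic if $g_{2m-1}=1_G$. Let $H$ be a group of order $m$, $K$ a group of order $k$, ${\bf h}: h_0,\ldots,h_{2m-1}$ a D-sequence in $H$ and ${\bf g}: g_0,\ldots,g_{2km-1}$ a D-sequence in $G=H\times K$. Then ${\bf g}$ is a lift of ${\bf h}$ by $K$ if $\pi(g_{i+2tm})=h_i$ for all $0\le i\le 2m-1$ and $0\le t\le k-1$, where $\pi:G\to H$ is the projection onto the first component. *)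

theory Defs
  imports "HOL-Algebra.Algebra"
begin

text \<open>
  A finite sequence of length \<open>l + 1\<close> is represented by a function on \<^typ>\<open>nat\<close> of which only the
  values at \<open>0, \<dots>, l\<close> matter.
\<close>

definition quotients :: "('a, 'b) monoid_scheme \<Rightarrow> (nat \<Rightarrow> 'a) \<Rightarrow> nat \<Rightarrow> 'a" where
  "quotients G g i = (if i = 0 then \<one>\<^bsub>G\<^esub> else inv\<^bsub>G\<^esub> (g (i - 1)) \<otimes>\<^bsub>G\<^esub> g i)"

definition D_sequence :: "('a, 'b) monoid_scheme \<Rightarrow> (nat \<Rightarrow> 'a) \<Rightarrow> bool" where
  "D_sequence G g \<longleftrightarrow>
     (\<forall>i < 2 * order G. g i \<in> carrier G) \<and>
     g 0 = \<one>\<^bsub>G\<^esub> \<and>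
     (\<forall>x \<in> carrier G. card {i. i < 2 * order G \<and> g i = x} = 2) \<and>
     (\<forall>x \<in> carrier G. card {i. i < 2 * order G \<and> quotients G g i = x} = 2)"

definition cyclic_D_sequence :: "('a, 'b) monoid_scheme \<Rightarrow> (nat \<Rightarrow> 'a) \<Rightarrow> bool" where
  "cyclic_D_sequence G g \<longleftrightarrow> D_sequence G g \<and> g (2 * order G - 1) = \<one>\<^bsub>G\<^esub>"

definition is_lift ::
  "('a, 'b) monoid_scheme \<Rightarrow> ('c, 'd) monoid_scheme \<Rightarrow> (nat \<Rightarrow> 'a) \<Rightarrow> (nat \<Rightarrow> 'a \<times> 'c) \<Rightarrow> bool" where
  "is_lift H K h g \<longleftrightarrow>
     D_sequence H h \<and> D_sequence (H \<times>\<times> K) g \<and>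
     (\<forall>i < 2 * order H. \<forall>t < order K. fst (g (i + 2 * t * order H)) = h i)"

end

theory Submission
  imports Defs "HOL-Number_Theory.Cong"
begin

text \<open>
  Let \<open>m\<close> be the order of \<open>H\<close> and \<open>k\<close> a positive multiple of 4; the powers \<open>2 ^ n\<close> with \<open>n \<ge> 2\<close> are
  of this kind. A lift of \<open>h\<close> by the integers modulo \<open>k\<close> amounts to a table with \<open>k\<close> rows and \<open>2 * m\<close>
  columns, read row by row, whose entry in row \<open>t\<close> and column \<open>i\<close> is the second component at
  position \<open>i + 2 * m * t\<close>; the first component there is \<open>h i\<close>. Because \<open>h\<close> is cyclic, the
  quotient at such a position has first component \<open>quotients H h i\<close>, also where one row ends
  and the next begins. So the lift is a D-sequence as soon as the following holds: for every element
  \<open>x\<close> of \<open>H\<close>, the two columns \<open>i\<close> with \<open>h i = x\<close> together contain every residue twice, and the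
  successive differences leading into the two columns with quotient \<open>x\<close> together contain every residue twice.

  The first condition is met by making every column \<open>C i\<close> a permutation of the residues. With
  \<open>C i t = (-1) ^ i * p t + b i\<close> for one permutation \<open>p\<close>, the difference of neighbouring columns is
  \<open>2 * p t\<close>, up to sign, plus the constant \<open>b i - b (i - 1)\<close>. It takes each even residue twice or each
  odd residue twice, depending on the parity of that constant. Hence the second condition
  holds for two columns with the same quotient when exactly one of their constants is odd.

  The exceptional quotient is 1, which belongs to column 0, where the step comes from the previous row,
  and to one further column \<open>q\<close>. Since the constants telescope around a row, using a single \<open>p\<close> forces
  \<open>m\<close> to be odd. To remove this obstruction, the columns before \<open>q\<close> use the identity and
  those from \<open>q\<close> on use a second permutation \<open>g\<close>. Only the steps into the columns 0 and \<open>q\<close> then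
  change: up to sign and constants, both are the sum \<open>t + g t\<close>. For even \<open>m\<close> the permutation \<open>twist\<close>
  makes this sum take multiples of 4 twice, odd residues once and the other residues never; this
  distribution is symmetric under negation and complementary to its translate by 2, so
  the constants can be matched (lemma \<open>complementary_sums\<close>). The columns are assembled in
  \<open>lifting_columns\<close>, and \<open>quotients_row_major\<close> computes the quotients of the resulting sequence.
\<close>

section \<open>Value distributions of maps on residues\<close>

definition hits :: "int \<Rightarrow> (int \<Rightarrow> int) \<Rightarrow> int \<Rightarrow> nat" where
  "hits k f y = card {t \<in> {0..<k}. [f t = y] (mod k)}"

definition permutes_residues :: "int \<Rightarrow> (int \<Rightarrow> int) \<Rightarrow> bool" where
  "permutes_residues k f \<longleftrightarrow> bij_betw (\<lambda>t. f t mod k) {0..<k} {0..<k}"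

lemma permutes_residuesI:
  assumes "k > 0"
    and "\<And>s t. s \<in> {0..<k} \<Longrightarrow> t \<in> {0..<k} \<Longrightarrow> [f s = f t] (mod k) \<Longrightarrow> s = t"
  shows "permutes_residues k f"
proof -
  have inj: "inj_on (\<lambda>t. f t mod k) {0..<k}"
    using assms(2) unfolding cong_def by (rule inj_onI)
  have "(\<lambda>t. f t mod k) ` {0..<k} = {0..<k}"
    by (rule card_subset_eq) (use assms(1) inj in \<open>auto simp: card_image\<close>)
  with inj show ?thesis
    by (simp add: permutes_residues_def bij_betw_def)
qed

lemma hits_cong:
  assumes "\<And>t. t \<in> {0..<k} \<Longrightarrow> [f t = f' t] (mod k)" and "[y = y'] (mod k)"
  shows "hits k f y = hits k f' y'"
proof -
  have "[f t = y] (mod k) \<longleftrightarrow> [f' t = y'] (mod k)" if "t \<in> {0..<k}" for t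
    using assms(1)[OF that] assms(2) by (simp add: cong_def)
  then show ?thesis by (simp add: hits_def cong: conj_cong)
qed

lemma hits_comp_bij:
  assumes "bij_betw p {0..<k} {0..<k}"
  shows "hits k (\<lambda>t. f (p t)) y = hits k f y"
proof -
  have inj: "inj_on p {0..<k}" and img: "p ` {0..<k} = {0..<k}"
    using assms by (simp_all add: bij_betw_def)
  have "p ` {t \<in> {0..<k}. [f (p t) = y] (mod k)} = {t \<in> p ` {0..<k}. [f t = y] (mod k)}"
    by blast
  moreover have "card (p ` {t \<in> {0..<k}. [f (p t) = y] (mod k)})
      = card {t \<in> {0..<k}. [f (p t) = y] (mod k)}"
    by (rule card_image) (rule inj_on_subset[OF inj], blast)
  ultimately show ?thesis
    unfolding hits_def img by (simp only:)
qed

lemma hits_comp_permutes_residues: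
  assumes "permutes_residues k p" and "\<And>a b. [a = b] (mod k) \<Longrightarrow> [f a = f b] (mod k)"
  shows "hits k (\<lambda>t. f (p t)) y = hits k f y"
proof -
  have "hits k (\<lambda>t. f (p t)) y = hits k (\<lambda>t. f (p t mod k)) y"
  proof (rule hits_cong)
    show "[f (p t) = f (p t mod k)] (mod k)" for t
      by (intro assms(2)[of "p t" "p t mod k"]) (simp only: cong_def mod_mod_trivial)
    show "[y = y] (mod k)" by (rule cong_refl)
  qed
  also have "\<dots> = hits k f y"
    by (rule hits_comp_bij[OF assms(1)[unfolded permutes_residues_def], of f])
  finally show ?thesis .
qed

lemma hits_signed_affine:
  assumes "s = 1 \<or> s = -1"
  shows "hits k (\<lambda>t. s * f t + b) y = hits k f (s * (y - b))"
proof -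
  have "[s * f t + b = y] (mod k) \<longleftrightarrow> [f t = s * (y - b)] (mod k)" for t
  proof -
    have "s * f t + b - y = s * (f t - s * (y - b))"
      using assms by (auto simp: algebra_simps)
    moreover have "k dvd s * z \<longleftrightarrow> k dvd z" for z
      using assms by auto
    ultimately show ?thesis
      by (simp only: cong_iff_dvd_diff)
  qed
  then show ?thesis by (simp add: hits_def)
qed

lemma hits_id:
  assumes "k > 0"
  shows "hits k (\<lambda>t. t) y = 1"
proof -
  have "{t \<in> {0..<k}. [t = y] (mod k)} = {y mod k}"
    using assms by (auto simp: cong_def)
  then show ?thesis by (simp add: hits_def)
qed

lemma hits_permutes_residues:
  assumes "k > 0" "permutes_residues k p" "s = 1 \<or> s = -1"
  shows "hits k (\<lambda>t. s * p t + b) y = 1"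
  using hits_comp_permutes_residues[OF assms(2), of "\<lambda>t. t"] hits_id[OF assms(1)]
  by (simp add: hits_signed_affine[OF assms(3)])

lemma cong_iff_eq_or_eq_plus:
  fixes a b k :: int
  assumes "- k < a - b" "a - b < 2 * k"
  shows "[a = b] (mod k) \<longleftrightarrow> a = b \<or> a = b + k"
proof
  assume "[a = b] (mod k)"
  then obtain j where j: "a - b = k * j" by (auto simp: cong_iff_dvd_diff)
  have "k > 0" using assms by linarith
  have "k * (-1) < k * j" "k * j < k * 2" using assms by (simp_all flip: j)
  then have "-1 < j" "j < 2"
    using mult_less_cancel_left_pos[OF \<open>k > 0\<close>] by blast+
  then have "j = 0 \<or> j = 1" by linarith
  then show "a = b \<or> a = b + k" using j by auto
qed (auto simp: cong_def)

lemma hits_double: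
  assumes "k > 0" "even k"
  shows "hits k (\<lambda>t. 2 * t) y = (if even y then 2 else 0)"
proof -
  obtain l where l: "k = 2 * l" using assms(2) by blast
  define z where "z = y mod k"
  have z: "0 \<le> z" "z < k" "even z \<longleftrightarrow> even y"
    using assms by (auto simp: z_def l dvd_mod_iff)
  have iff: "[2 * t = z] (mod k) \<longleftrightarrow> 2 * t = z \<or> 2 * t = z + k" if "t \<in> {0..<k}" for t
    using that z by (intro cong_iff_eq_or_eq_plus) auto
  have "hits k (\<lambda>t. 2 * t) y = hits k (\<lambda>t. 2 * t) z"
    by (rule hits_cong) (auto simp: z_def cong_def)
  also have "hits k (\<lambda>t. 2 * t) z = card {t \<in> {0..<k}. 2 * t = z \<or> 2 * t = z + k}"
    unfolding hits_def by (rule arg_cong[of _ _ card]) (use iff in blast)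
  also have "{t \<in> {0..<k}. 2 * t = z \<or> 2 * t = z + k} = (if even z then {z div 2, z div 2 + l} else {})"
    using z(1,2) unfolding l by (auto elim!: evenE) presburger
  also have "card \<dots> = (if even z then 2 else 0)"
    using assms l by auto
  finally show ?thesis using z(3) by simp
qed

text \<open>
  The difference of two columns with opposite signs has this form, so up to the parity of the
  constant \<open>b\<close> its distribution depends neither on the permutation nor on the sign.
\<close>

lemma hits_signed_double:
  assumes "k > 0" "even k" "permutes_residues k p" "s = 1 \<or> s = -1"
  shows "hits k (\<lambda>t. s * (2 * p t) + b) y = (if even (y - b) then 2 else 0)"
proof -
  have "hits k (\<lambda>t. 2 * p t) z = hits k (\<lambda>t. 2 * t) z" for z
    by (rule hits_comp_permutes_residues[OF assms(3)]) (rule cong_scalar_left)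
  then show ?thesis
    using assms(4) by (auto simp: hits_signed_affine[OF assms(4)] hits_double[OF assms(1,2)])
qed

text \<open>
  Used for the step into column 0, which subtracts the entry of the preceding row; the first row is
  preceded cyclically by the last.
\<close>

lemma hits_rotate:
  assumes "k > 0"
  shows "hits k (\<lambda>t. f ((t - 1) mod k)) y = hits k f y"
proof -
  have "permutes_residues k (\<lambda>t. t - 1)"
  proof (rule permutes_residuesI[OF assms])
    fix s t assume st: "s \<in> {0..<k}" "t \<in> {0..<k}" and "[s - 1 = t - 1] (mod k)"
    then have "[s - 1 + 1 = t - 1 + 1] (mod k)" by (intro cong_add cong_refl)
    then show "s = t" using st by (simp add: cong_def)
  qed
  then show ?thesis
    unfolding permutes_residues_def by (rule hits_comp_bij)
qed

section \<open>A permutation for even orders\<close>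

text \<open>
  The upper half of the residues is moved down by 1, so that the sums \<open>t + twist k t = 2 * t - 1\<close> run
  through the odd residues. This vacates \<open>k - 1\<close> and occupies \<open>k div 2 - 1\<close>; moving the odd residues
  of the lower half down by 2 repairs both, since 1 goes to \<open>-1\<close>, which is \<open>k - 1\<close> modulo \<open>k\<close>. In the lower half
  the sums are \<open>2 * t\<close> for even and \<open>2 * t - 2\<close> for odd \<open>t\<close>, so \<open>2 * a\<close> and \<open>2 * a + 1\<close>
  share the sum \<open>4 * a\<close>.
\<close>

definition twist :: "int \<Rightarrow> int \<Rightarrow> int" where
  "twist k t = (if k \<le> 2 * t then t - 1 else if even t then t else t - 2)"

lemma permutes_residues_twist:
  assumes "k > 0" "4 dvd k"
  shows "permutes_residues k (twist k)"
proof (rule permutes_residuesI[OF assms(1)])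
  fix s t assume st: "s \<in> {0..<k}" "t \<in> {0..<k}" and c: "[twist k s = twist k t] (mod k)"
  obtain l where l: "k = 4 * l" using assms(2) by blast
  have bounds: "-1 \<le> twist k x" "twist k x \<le> k - 2" if "x \<in> {0..<k}" for x
    using that l by (auto simp: twist_def elim!: evenE oddE)
  \<comment> \<open>The values lie in a window of length \<open>k\<close> that starts at \<open>-1\<close>; shifted by 1 they are their own residues.\<close>
  have "[twist k s + 1 = twist k t + 1] (mod k)" using c by (rule cong_add) simp
  then have "twist k s = twist k t"
    using bounds[OF st(1)] bounds[OF st(2)] by (auto simp: cong_def)
  then show "s = t"
    using st unfolding twist_def l by (auto split: if_splits elim!: evenE oddE) presburger+
qed

lemma hits_twist:
  assumes "k > 0" "4 dvd k"
  shows "hits k (\<lambda>t. t + twist k t) y = (if 4 dvd y then 2 else if odd y then 1 else 0)"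
proof -
  obtain l where l: "k = 4 * l" using assms(2) by blast
  define z where "z = y mod k"
  have z: "0 \<le> z" "z < k" "even z \<longleftrightarrow> even y" "4 dvd z \<longleftrightarrow> 4 dvd y"
    using assms by (auto simp: z_def l dvd_mod_iff)
  have iff: "[t + twist k t = z] (mod k) \<longleftrightarrow> t + twist k t = z \<or> t + twist k t = z + k"
    if "t \<in> {0..<k}" for t
  proof (rule cong_iff_eq_or_eq_plus)
    show "- k < t + twist k t - z" "t + twist k t - z < 2 * k"
      using that z(1,2) by (cases "t = 0"; auto simp: twist_def)+
  qed
  have "hits k (\<lambda>t. t + twist k t) y = hits k (\<lambda>t. t + twist k t) z"
    by (rule hits_cong) (auto simp: z_def cong_def)
  \<comment> \<open>An odd \<open>z\<close> is \<open>2 * t - 1\<close> or \<open>2 * t - 1 - k\<close> with \<open>t\<close> in the upper half; the former only for \<open>z = k - 1\<close>.\<close>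
  also have "{t \<in> {0..<k}. [t + twist k t = z] (mod k)} =
      (if 4 dvd z then {z div 2, z div 2 + 1}
       else if odd z then {if z = k - 1 then 2 * l else (z + 1) div 2 + 2 * l} else {})"
    (is "?A = ?B")
  proof -
    have "t \<in> ?A \<longleftrightarrow> t \<in> ?B" for t
    proof -
      have "t \<in> ?A \<longleftrightarrow> 0 \<le> t \<and> t < k \<and> (t + twist k t = z \<or> t + twist k t = z + k)"
        using iff by simp blast
      also have "\<dots> \<longleftrightarrow> t \<in> ?B"
        (is "?L \<longleftrightarrow> ?R")
      proof -
        have "(\<exists>a. z = 4 * a) \<or> (\<exists>a. z = 4 * a + 2) \<or> (\<exists>a. z = 2 * a + 1)" by presburger
        then consider a where "z = 4 * a" | a where "z = 4 * a + 2" | a where "z = 2 * a + 1"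
          by blast
        then show ?thesis
        proof cases
          case (1 a)
          have "?R \<longleftrightarrow> t = 2 * a \<or> t = 2 * a + 1" unfolding 1 by simp
          moreover have "?L \<longleftrightarrow> t = 2 * a \<or> t = 2 * a + 1"
            using z(1,2) unfolding twist_def 1 l
            by (auto elim!: evenE oddE split: if_splits) presburger+
          ultimately show ?thesis by (simp only:)
        next
          case (2 a)
          have "\<not> 4 dvd z" unfolding 2 by presburger
          then have "\<not> ?R" unfolding 2 by simp
          moreover have "\<not> ?L"
            using z(1,2) unfolding twist_def 2 l
            by (auto elim!: evenE oddE split: if_splits) presburger+
          ultimately show ?thesis by (simp only:)
        next
          case (3 a)
          have "\<not> 4 dvd z" unfolding 3 by presburger
          then have "?R \<longleftrightarrow> t = (if a = 2 * l - 1 then 2 * l else a + 1 + 2 * l)"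
            unfolding 3 l by (simp add: algebra_simps)
          moreover have "?L \<longleftrightarrow> t = (if a = 2 * l - 1 then 2 * l else a + 1 + 2 * l)"
            using z(1,2) unfolding twist_def 3 l
            by (auto elim!: evenE oddE split: if_splits; presburger)
          ultimately show ?thesis by (simp only:)
        qed
      qed
      finally show ?thesis .
    qed
    then show ?thesis by blast
  qed
  then have "hits k (\<lambda>t. t + twist k t) z = (if 4 dvd z then 2 else if odd z then 1 else 0)"
    by (auto simp: hits_def)
  finally show ?thesis using z(3,4) by simp
qed

text \<open>
  This settles the two columns with quotient 1. The first summand describes the step into column 0
  and the second the step into column \<open>q\<close>, where \<open>s\<close> is the sign of column \<open>q\<close>. The constants come from
  the closing condition: the entry \<open>k - 1\<close> of the last column has to vanish, which fixes the sum of
  all constants to \<open>g (k - 1)\<close>; the other \<open>m - 1\<close> quotients contribute \<open>\<epsilon>\<close> each.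

  For odd \<open>m\<close> the identity suffices: both maps are \<open>2 * t\<close> up to sign and constants, and the constants
  have different parities. For even \<open>m\<close>, \<open>twist\<close> gives \<open>g (k - 1) = k - 2\<close>, so the first
  constant is 3 modulo 4, and the sign \<open>\<epsilon>\<close> is chosen to make the second one 1 modulo 4. The two shifts
  then differ by 2 modulo 4, which exchanges the residues taken twice and those never taken.
\<close>

lemma complementary_sums:
  fixes k :: int and m :: nat
  assumes "k > 0" "4 dvd k"
  shows "\<exists>g \<epsilon>. permutes_residues k g \<and> (\<epsilon> = 1 \<or> \<epsilon> = -1) \<and>
    (\<forall>s y. s = 1 \<or> s = -1 \<longrightarrow>
       hits k (\<lambda>t. t + g t + (1 - g (k - 1))) y
       + hits k (\<lambda>t. s * (t + g t) + (g (k - 1) - \<epsilon> * (int m - 1))) y = 2)"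
proof (cases "odd m")
  case True
  have "even k" using assms(2) by presburger
  have p: "permutes_residues k (\<lambda>t. t)"
    by (rule permutes_residuesI[OF assms(1)]) (auto simp: cong_def)
  show ?thesis
  proof (intro exI[of _ "\<lambda>t. t"] exI[of _ 1] conjI allI impI)
    fix s y :: int assume s: "s = 1 \<or> s = -1"
    show "hits k (\<lambda>t. t + t + (1 - (k - 1))) y
       + hits k (\<lambda>t. s * (t + t) + (k - 1 - 1 * (int m - 1))) y = 2"
      using hits_signed_double[OF assms(1) \<open>even k\<close> p s, of "k - 1 - (int m - 1)" y]
        hits_signed_double[OF assms(1) \<open>even k\<close> p, of 1 "1 - (k - 1)" y] True \<open>even k\<close>
      by (simp add: mult_2[symmetric])
  qed (use p in auto)
next
  case False
  define \<epsilon> :: int where "\<epsilon> = (if 4 dvd m then -1 else 1)"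
  have last: "twist k (k - 1) = k - 2"
    using assms by (auto simp: twist_def elim!: dvdE)
  have u: "4 dvd (k - 2 - \<epsilon> * (int m - 1)) - 1"
  proof (cases "4 dvd m")
    case True
    then obtain a where "m = 4 * a" by blast
    then show ?thesis using assms(2) by (auto simp: \<epsilon>_def elim!: dvdE)
  next
    case F: False
    then have "int m mod 4 = 2" using False by presburger
    then show ?thesis using F assms(2) by (simp add: \<epsilon>_def) presburger
  qed
  show ?thesis
  proof (intro exI[of _ "twist k"] exI[of _ \<epsilon>] conjI allI impI)
    fix s y :: int assume s: "s = 1 \<or> s = -1"
    have "hits k (\<lambda>t. t + twist k t + (1 - (k - 2))) y = hits k (\<lambda>t. t + twist k t) (y - (3 - k))"
      using hits_signed_affine[of 1 k "\<lambda>t. t + twist k t" "1 - (k - 2)" y] by simp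
    moreover have "hits k (\<lambda>t. s * (t + twist k t) + (k - 2 - \<epsilon> * (int m - 1))) y
      = hits k (\<lambda>t. t + twist k t) (s * (y - (k - 2 - \<epsilon> * (int m - 1))))"
      by (rule hits_signed_affine[OF s])
    moreover have "4 dvd y - (3 - k) \<longleftrightarrow> 4 dvd y - 3" "odd (y - (3 - k)) \<longleftrightarrow> even y"
      using assms(2) by presburger+
    moreover have "4 dvd s * (y - (k - 2 - \<epsilon> * (int m - 1))) \<longleftrightarrow> 4 dvd y - 1"
      "odd (s * (y - (k - 2 - \<epsilon> * (int m - 1)))) \<longleftrightarrow> even y"
    proof -
      define u where "u = k - 2 - \<epsilon> * (int m - 1)"
      have "4 dvd u - 1" using u unfolding u_def .
      then have "4 dvd y - u \<longleftrightarrow> 4 dvd y - 1" "odd (y - u) \<longleftrightarrow> even y" by presburger+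
      then show "4 dvd s * (y - (k - 2 - \<epsilon> * (int m - 1))) \<longleftrightarrow> 4 dvd y - 1"
        "odd (s * (y - (k - 2 - \<epsilon> * (int m - 1)))) \<longleftrightarrow> even y"
        using s unfolding u_def[symmetric] by (auto simp: dvd_diff_commute)
    qed
    ultimately have "hits k (\<lambda>t. t + twist k t + (1 - twist k (k - 1))) y
       + hits k (\<lambda>t. s * (t + twist k t) + (twist k (k - 1) - \<epsilon> * (int m - 1))) y
       = (if 4 dvd y - 3 then 2 else if even y then 1 else 0)
       + (if 4 dvd y - 1 then 2 else if even y then 1 else 0)"
      unfolding last hits_twist[OF assms] by (simp only:)
    also have "\<dots> = 2" by presburger
    finally show "hits k (\<lambda>t. t + twist k t + (1 - twist k (k - 1))) y
       + hits k (\<lambda>t. s * (t + twist k t) + (twist k (k - 1) - \<epsilon> * (int m - 1))) y = 2" .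
  qed (use permutes_residues_twist[OF assms] in \<open>auto simp: \<epsilon>_def\<close>)
qed

section \<open>The table of second components\<close>

text \<open>
  The step into column \<open>i\<close> of a table with \<open>l\<close> columns. Column 0 is entered from the last column one
  row higher; for row 0 this is the last row, so the step there is 0, like the quotient at
  position 0, when both the first and the very last entry are 0.
\<close>

definition column_step :: "nat \<Rightarrow> int \<Rightarrow> (nat \<Rightarrow> int \<Rightarrow> int) \<Rightarrow> nat \<Rightarrow> int \<Rightarrow> int" where
  "column_step l k C i t =
     (if i = 0 then C 0 t - C (l - 1) ((t - 1) mod k) else C i t - C (i - 1) t)"

text \<open>
  The labels \<open>\<alpha> i\<close> stand for the quotients of \<open>h\<close>; only their pairing of the columns matters. Column
  \<open>i\<close> gets the sign \<open>(-1) ^ i\<close> and the constant \<open>b i\<close>, the sum of increments \<open>d j\<close> over \<open>j \<le> i\<close>. In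
  each pair other than that of column 0, one increment is \<open>\<epsilon>\<close>, hence odd, and the other is 0, so the
  steps take the odd and the even residues twice each. The remaining increment, at the partner \<open>q\<close> of
  column 0, is forced by the closing condition, and \<open>complementary_sums\<close> treats that pair.
\<close>

lemma lifting_columns:
  fixes \<alpha> :: "nat \<Rightarrow> 'a" and k :: int and m :: nat
  assumes "k > 0" "4 dvd k" "m > 0" "finite L" "card L = m"
    and mem: "\<And>i. i < 2 * m \<Longrightarrow> \<alpha> i \<in> L"
    and two: "\<And>x. x \<in> L \<Longrightarrow> card {i. i < 2 * m \<and> \<alpha> i = x} = 2"
  obtains C where "C 0 0 = 0" "C (2 * m - 1) (k - 1) = 0"
    "\<And>i y. i < 2 * m \<Longrightarrow> hits k (C i) y = 1"
    "\<And>x y. x \<in> L \<Longrightarrow>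
       (\<Sum>i | i < 2 * m \<and> \<alpha> i = x. hits k (column_step (2 * m) k C i) y) = 2"
proof -
  obtain g \<epsilon> where g: "permutes_residues k g" and \<epsilon>: "\<epsilon> = 1 \<or> \<epsilon> = -1"
    and compl: "\<And>s y. s = 1 \<or> s = -1 \<Longrightarrow>
       hits k (\<lambda>t. t + g t + (1 - g (k - 1))) y
       + hits k (\<lambda>t. s * (t + g t) + (g (k - 1) - \<epsilon> * (int m - 1))) y = 2"
    using complementary_sums[OF assms(1,2), of m] by blast
  have id: "permutes_residues k (\<lambda>t. t)"
    by (rule permutes_residuesI[OF assms(1)]) (auto simp: cong_def)
  have "even k" using assms(2) by presburger
  define e where "e = g (k - 1)"
  define fib where "fib x = {i. i < 2 * m \<and> \<alpha> i = x}" for x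
  have lab0: "\<alpha> 0 \<in> L" using mem \<open>m > 0\<close> by simp
  have "0 \<in> fib (\<alpha> 0)" using \<open>m > 0\<close> by (simp add: fib_def)
  moreover obtain u v where "fib (\<alpha> 0) = {u, v}" "u \<noteq> v"
    using two[OF lab0] unfolding fib_def[symmetric] by (auto simp: card_2_iff)
  ultimately obtain q where q: "fib (\<alpha> 0) = {0, q}" "q \<noteq> 0" by force
  have q_less: "q < 2 * m" and q_lab: "\<alpha> q = \<alpha> 0"
    using q(1) unfolding fib_def by blast+
  \<comment> \<open>The first column of each pair receives the odd increment.\<close>
  define d :: "nat \<Rightarrow> int" where
    "d j = (if j = 0 then 0 else if j = q then e - \<epsilon> * (int m - 1)
            else if \<forall>i<j. \<alpha> i \<noteq> \<alpha> j then \<epsilon> else 0)" for j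
  have d0: "d 0 = 0" and dq: "d q = e - \<epsilon> * (int m - 1)"
    using q(2) by (simp_all add: d_def)
  have pair: "\<exists>a b. fib x = {a, b} \<and> a \<noteq> b \<and> a \<notin> {0, q} \<and> b \<notin> {0, q} \<and> d a = \<epsilon> \<and> d b = 0"
    if x: "x \<in> L" "x \<noteq> \<alpha> 0" for x
  proof -
    obtain a b where ab: "fib x = {a, b}" "a < b"
    proof -
      obtain u v where "fib x = {u, v}" "u \<noteq> v"
        using two[OF x(1)] unfolding fib_def[symmetric] by (auto simp: card_2_iff)
      then show thesis
        using that[of u v] that[of v u] by (cases "u < v") (auto simp: insert_commute)
    qed
    have iff: "i < 2 * m \<and> \<alpha> i = x \<longleftrightarrow> i = a \<or> i = b" for i
      using ab(1) unfolding fib_def by blast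
    have ax: "\<alpha> a = x" "\<alpha> b = x" "b < 2 * m" using iff by blast+
    have "c \<notin> {0, q}" if "\<alpha> c = x" for c
      using that x(2) q_lab by (cases "c = 0"; cases "c = q") auto
    then have "a \<notin> {0, q}" "b \<notin> {0, q}" using ax(1,2) by blast+
    moreover have "\<alpha> i \<noteq> \<alpha> a" if "i < a" for i
      using iff[of i] that ab(2) ax by auto
    moreover have "\<not> (\<forall>i<b. \<alpha> i \<noteq> \<alpha> b)"
      unfolding ax(2) using ab(2) ax(1) by blast
    ultimately have "d a = \<epsilon>" "d b = 0" by (auto simp: d_def)
    with \<open>a \<notin> {0, q}\<close> \<open>b \<notin> {0, q}\<close> ab show ?thesis by blast
  qed
  define b where "b i = (\<Sum>j\<le>i. d j)" for i
  have b_Suc: "b i = b (i - 1) + d i" if "i > 0" for i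
    using that by (cases i) (simp_all add: b_def)
  have b_last: "b (2 * m - 1) = e"
  proof -
    have "b (2 * m - 1) = (\<Sum>j\<in>{..<2 * m}. d j)"
      unfolding b_def using \<open>m > 0\<close> by (intro sum.cong) auto
    also have "\<dots> = (\<Sum>x\<in>L. \<Sum>j | j \<in> {..<2 * m} \<and> \<alpha> j = x. d j)"
      using mem \<open>finite L\<close> by (intro sum.group[symmetric]) auto
    also have "\<dots> = (\<Sum>x\<in>L. \<Sum>j\<in>fib x. d j)"
      by (simp add: fib_def)
    also have "\<dots> = (\<Sum>j\<in>fib (\<alpha> 0). d j) + (\<Sum>x\<in>L - {\<alpha> 0}. \<Sum>j\<in>fib x. d j)"
      using lab0 \<open>finite L\<close> by (rule sum.remove[rotated])
    also have "(\<Sum>j\<in>fib (\<alpha> 0). d j) = e - \<epsilon> * (int m - 1)"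
      unfolding q(1) using q(2) d0 dq by simp
    also have "(\<Sum>x\<in>L - {\<alpha> 0}. \<Sum>j\<in>fib x. d j) = (\<Sum>x\<in>L - {\<alpha> 0}. \<epsilon>)"
    proof (rule sum.cong)
      fix x assume "x \<in> L - {\<alpha> 0}"
      with pair[of x] show "(\<Sum>j\<in>fib x. d j) = \<epsilon>" by auto
    qed simp
    also have "\<dots> = (int m - 1) * \<epsilon>"
      using lab0 assms(3-5) by (simp add: card_Diff_singleton of_nat_diff)
    finally show ?thesis by simp
  qed
  define C where "C i t = (-1) ^ i * (if i < q then t else g t) + b i" for i t
  have sgn: "(-1) ^ i = (1 :: int) \<or> (-1) ^ i = (-1 :: int)" for i :: nat
    by (cases "even i") auto
  have odd_last: "(-1) ^ (2 * m - 1) = (-1 :: int)" using \<open>m > 0\<close> by simp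
  have C_last: "C (2 * m - 1) t = e - g t" for t
  proof -
    have "\<not> 2 * m - 1 < q" using q_less by linarith
    then show ?thesis unfolding C_def odd_last b_last by simp
  qed
  have C_0: "C 0 t = t" for t
    using q(2) by (simp add: C_def b_def d0)
  have sgn_pred: "(-1 :: int) ^ (i - 1) = - ((-1) ^ i)" if "i > 0" for i :: nat
    using that by (cases i) simp_all
  have step_0: "hits k (column_step (2 * m) k C 0) y = hits k (\<lambda>t. t + g t + (1 - e)) y" for y
  proof -
    have "hits k (column_step (2 * m) k C 0) y
        = hits k (\<lambda>t. (t - 1) mod k + g ((t - 1) mod k) + (1 - e)) y"
    proof (rule hits_cong)
      fix t
      have "column_step (2 * m) k C 0 t = (t - 1) + (g ((t - 1) mod k) + (1 - e))"
        unfolding column_step_def C_0 C_last by simp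
      moreover have "[(t - 1) + z = (t - 1) mod k + z] (mod k)" for z
        by (intro cong_add cong_refl) (simp add: cong_def)
      ultimately show "[column_step (2 * m) k C 0 t = (t - 1) mod k + g ((t - 1) mod k) + (1 - e)] (mod k)"
        by (simp only: add.assoc)
    qed (rule cong_refl)
    also have "\<dots> = hits k (\<lambda>t. t + g t + (1 - e)) y"
      by (rule hits_rotate[OF assms(1), of "\<lambda>t. t + g t + (1 - e)"])
    finally show ?thesis .
  qed
  have step_q: "column_step (2 * m) k C q = (\<lambda>t. (-1) ^ q * (t + g t) + (e - \<epsilon> * (int m - 1)))"
  proof
    fix t
    have "C q t = (-1) ^ q * g t + b q" by (simp add: C_def)
    moreover have "C (q - 1) t = - ((-1) ^ q * t) + b (q - 1)"
      using q(2) sgn_pred[of q] by (simp add: C_def)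
    moreover have "column_step (2 * m) k C q t = C q t - C (q - 1) t"
      using q(2) by (simp add: column_step_def)
    ultimately show "column_step (2 * m) k C q t = (-1) ^ q * (t + g t) + (e - \<epsilon> * (int m - 1))"
      using q(2) b_Suc[of q] dq by (simp only: distrib_left)
  qed
  have step_other: "hits k (column_step (2 * m) k C j) y = (if even (y - d j) then 2 else 0)"
    if j: "j \<notin> {0, q}" for j y
  proof -
    define p where "p = (if j < q then (\<lambda>t. t) else g)"
    have "column_step (2 * m) k C j = (\<lambda>t. (-1) ^ j * (2 * p t) + d j)"
    proof
      fix t
      have "C j t = (-1) ^ j * p t + b j" by (simp add: C_def p_def)
      moreover have "j - 1 < q \<longleftrightarrow> j < q" using j by (cases j) auto
      then have "C (j - 1) t = - ((-1) ^ j * p t) + b (j - 1)"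
        using j sgn_pred[of j] by (simp add: C_def p_def)
      moreover have "column_step (2 * m) k C j t = C j t - C (j - 1) t"
        using j by (simp add: column_step_def)
      ultimately show "column_step (2 * m) k C j t = (-1) ^ j * (2 * p t) + d j"
        using j b_Suc[of j] by simp
    qed
    moreover have "permutes_residues k p" using id g by (simp add: p_def)
    ultimately show ?thesis
      using hits_signed_double[OF assms(1) \<open>even k\<close> _ sgn[of j], of p "d j" y]
      by simp
  qed
  show thesis
  proof (rule that)
    show "C 0 0 = 0" by (rule C_0)
    show "C (2 * m - 1) (k - 1) = 0" unfolding C_last e_def by simp
    show "hits k (C i) y = 1" for i y
      unfolding C_def using hits_permutes_residues[OF assms(1) _ sgn] id g
      by (cases "i < q") simp_all
    show "(\<Sum>i | i < 2 * m \<and> \<alpha> i = x. hits k (column_step (2 * m) k C i) y) = 2"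
      if x: "x \<in> L" for x y
    proof (cases "x = \<alpha> 0")
      case True
      show ?thesis
        unfolding fib_def[symmetric] True q(1)
        using q(2) compl[OF sgn[of q], of y] by (simp add: step_0 step_q e_def)
    next
      case False
      then obtain a c where ac: "fib x = {a, c}" "a \<noteq> c" "a \<notin> {0, q}" "c \<notin> {0, q}"
        "d a = \<epsilon>" "d c = 0"
        using pair[OF x] by blast
      show ?thesis
        unfolding fib_def[symmetric] ac(1)
        using ac(2,5,6) \<epsilon> by (auto simp: step_other[OF ac(3)] step_other[OF ac(4)])
    qed
  qed
qed

section \<open>Reading the table row by row\<close>

lemma card_div_mod_split:
  fixes l k :: nat
  assumes "l > 0"
  shows "card {j. j < l * k \<and> P (j mod l) (j div l)} = (\<Sum>i<l. card {t. t < k \<and> P i t})"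
proof -
  let ?S = "SIGMA i:{..<l}. {t. t < k \<and> P i t}"
  have "bij_betw (\<lambda>j. (j mod l, j div l)) {j. j < l * k \<and> P (j mod l) (j div l)} ?S"
  proof (rule bij_betw_byWitness[where f' = "\<lambda>(i, t). i + l * t"])
    have "i + l * t < l * k" if "i < l" "t < k" for i t
    proof -
      have "i + l * t < l * Suc t" using that by simp
      also have "\<dots> \<le> l * k" using that by (intro mult_le_mono2) simp
      finally show ?thesis .
    qed
    then show "(\<lambda>(i, t). i + l * t) ` ?S \<subseteq> {j. j < l * k \<and> P (j mod l) (j div l)}"
      by auto
  qed (use assms in \<open>auto simp: less_mult_imp_div_less mult.commute\<close>)
  then have "card {j. j < l * k \<and> P (j mod l) (j div l)} = card ?S"
    by (rule bij_betw_same_card)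
  then show ?thesis by simp
qed

lemma hits_eq_card_nat:
  "hits (int k) f y = card {t :: nat. t < k \<and> [f (int t) = y] (mod int k)}"
proof -
  have "bij_betw int {t. t < k \<and> [f (int t) = y] (mod int k)}
      {t \<in> {0..<int k}. [f t = y] (mod int k)}"
    by (rule bij_betw_byWitness[where f' = nat]) auto
  from bij_betw_same_card[OF this] show ?thesis by (simp add: hits_def)
qed

lemma card_row_major_entries:
  fixes l k :: nat and \<alpha> :: "nat \<Rightarrow> 'a"
  assumes "l > 0" "y \<in> {0..<int k}"
  shows "card {j. j < l * k \<and> (\<alpha> (j mod l), F (j mod l) (int (j div l)) mod int k) = (x, y)}
    = (\<Sum>i | i < l \<and> \<alpha> i = x. hits (int k) (F i) y)"
proof -
  have "(\<alpha> i, F i (int t) mod int k) = (x, y) \<longleftrightarrow> \<alpha> i = x \<and> [F i (int t) = y] (mod int k)" for i t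
    using assms(2) by (simp add: cong_def)
  then have "card {j. j < l * k \<and> (\<alpha> (j mod l), F (j mod l) (int (j div l)) mod int k) = (x, y)}
      = (\<Sum>i<l. card {t. t < k \<and> \<alpha> i = x \<and> [F i (int t) = y] (mod int k)})"
    using card_div_mod_split[OF assms(1), of k "\<lambda>i t. \<alpha> i = x \<and> [F i (int t) = y] (mod int k)"]
    by simp
  also have "\<dots> = (\<Sum>i<l. if \<alpha> i = x then hits (int k) (F i) y else 0)"
    by (intro sum.cong refl) (simp add: hits_eq_card_nat)
  also have "\<dots> = (\<Sum>i | i < l \<and> \<alpha> i = x. hits (int k) (F i) y)"
    using sum.inter_filter[of "{..<l}" "\<lambda>i. hits (int k) (F i) y" "\<lambda>i. \<alpha> i = x"] by simp
  finally show ?thesis .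
qed

lemma row_major_position:
  fixes i l t :: nat
  assumes "i < l"
  shows "(i + l * t) mod l = i" "(i + l * t) div l = t"
  using assms by auto

text \<open>
  At the start of a row \<open>t > 0\<close> the predecessor has first component \<open>h (l - 1)\<close>, which is 1, so the first component of
  the quotient is 1, as is \<open>quotients H h 0\<close>. This is where the cyclicity of \<open>h\<close> enters.
\<close>

lemma quotients_row_major:
  fixes H :: "('a, 'b) monoid_scheme" and k :: nat
  assumes "group H" "k > 0" "l > 0"
    and h: "\<And>i. i < l \<Longrightarrow> h i \<in> carrier H" "h 0 = \<one>\<^bsub>H\<^esub>" "h (l - 1) = \<one>\<^bsub>H\<^esub>"
    and C: "C 0 0 = 0" "C (l - 1) (int k - 1) = 0"
    and g: "\<And>j. g j = (h (j mod l), C (j mod l) (int (j div l)) mod int k)"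
    and j: "j < l * k"
  shows "quotients (H \<times>\<times> integer_mod_group k) g j
    = (quotients H h (j mod l), column_step l (int k) C (j mod l) (int (j div l)) mod int k)"
proof -
  interpret H: group H by fact
  have carr: "C i t mod int k \<in> carrier (integer_mod_group k)" for i t
    using \<open>k > 0\<close> by (simp add: carrier_integer_mod_group)
  have quot: "inv\<^bsub>H \<times>\<times> integer_mod_group k\<^esub> (x, C i t mod int k)
        \<otimes>\<^bsub>H \<times>\<times> integer_mod_group k\<^esub> (x', C i' t' mod int k)
      = (inv\<^bsub>H\<^esub> x \<otimes>\<^bsub>H\<^esub> x', (C i' t' - C i t) mod int k)"
    if "x \<in> carrier H" for x x' i i' t t'
  proof -
    have "(- (a mod int k) mod int k + b mod int k) mod int k = (b - a) mod int k" for a b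
      by (simp add: mod_simps uminus_add_conv_diff)
    then show ?thesis
      unfolding inv_DirProd[OF \<open>group H\<close> group_integer_mod_group that carr] mult_DirProd
        inv_integer_mod_group[OF carr] mult_integer_mod_group
      by simp
  qed
  show ?thesis
  proof (cases "j = 0")
    case True
    have "(-1) mod int k = int k - 1" using \<open>k > 0\<close> by (simp add: zmod_minus1)
    then show ?thesis using True C by (simp add: quotients_def column_step_def)
  next
    case False
    have quot_j: "quotients (H \<times>\<times> integer_mod_group k) g j
        = inv\<^bsub>H \<times>\<times> integer_mod_group k\<^esub> (g (j - 1)) \<otimes>\<^bsub>H \<times>\<times> integer_mod_group k\<^esub> g j"
      using False by (simp add: quotients_def)
    define i t where "i = j mod l" and "t = j div l"
    have ij: "j = i + l * t" "i < l" using \<open>l > 0\<close> by (simp_all add: i_def t_def)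
    have "t < k" using j by (simp add: t_def less_mult_imp_div_less mult.commute)
    show ?thesis
    proof (cases "i = 0")
      case True
      then have "t > 0" using ij False by (cases t) auto
      then have "j - 1 = (l - 1) + l * (t - 1)"
        using True ij(1) \<open>l > 0\<close> by (cases t) auto
      then have "(j - 1) mod l = l - 1" "(j - 1) div l = t - 1"
        using row_major_position[of "l - 1" l "t - 1"] \<open>l > 0\<close> by simp_all
      then have g_pred: "g (j - 1) = (\<one>\<^bsub>H\<^esub>, C (l - 1) (int t - 1) mod int k)"
        using g[of "j - 1"] h(3) \<open>t > 0\<close> by (simp add: of_nat_diff)
      have g_j: "g j = (\<one>\<^bsub>H\<^esub>, C 0 (int t) mod int k)"
        using g[of j] h(2) True by (simp add: i_def[symmetric] t_def[symmetric])
      have "(int t - 1) mod int k = int t - 1"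
        using \<open>t > 0\<close> \<open>t < k\<close> by (intro mod_pos_pos_trivial) auto
      then show ?thesis
        unfolding i_def[symmetric] t_def[symmetric] True quot_j g_j g_pred quot[OF H.one_closed]
        by (simp add: quotients_def column_step_def)
    next
      case i: False
      then have "j - 1 = (i - 1) + l * t" using ij by auto
      then have "(j - 1) mod l = i - 1" "(j - 1) div l = t"
        using ij(2) by auto
      then have g_pred: "g (j - 1) = (h (i - 1), C (i - 1) (int t) mod int k)"
        using g[of "j - 1"] by simp
      have g_j: "g j = (h i, C i (int t) mod int k)"
        using g[of j] by (simp add: i_def t_def)
      have "h (i - 1) \<in> carrier H" using ij(2) by (intro h(1)) simp
      then show ?thesis
        unfolding i_def[symmetric] t_def[symmetric] quot_j g_j g_pred
        using i by (simp add: quot quotients_def column_step_def)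
    qed
  qed
qed

section \<open>Lifting cyclic D-sequences\<close>

text \<open>
  Divisibility by 4 makes half of \<open>k\<close> even, so that \<open>twist\<close> can group the lower half of the residues
  into the pairs \<open>2 * a\<close>, \<open>2 * a + 1\<close>.
\<close>

theorem cyclic_D_sequence_lift_mod_multiple_of_4:
  fixes H :: "('a, 'b) monoid_scheme" and k :: nat
  assumes "group H" "finite (carrier H)" "k > 0" "4 dvd k" "cyclic_D_sequence H h"
  shows "\<exists>g. is_lift H (integer_mod_group k) h g \<and>
             cyclic_D_sequence (H \<times>\<times> integer_mod_group k) g"
proof -
  interpret H: group H by fact
  define m where "m = order H"
  have "m > 0" using H.order_gt_0_iff_finite assms(2) by (simp add: m_def)
  then have l: "2 * m > 0" by simp
  have D: "D_sequence H h" and h_last: "h (2 * m - 1) = \<one>\<^bsub>H\<^esub>"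
    using assms(5) by (simp_all add: cyclic_D_sequence_def m_def)
  have h_carr: "\<And>i. i < 2 * m \<Longrightarrow> h i \<in> carrier H" and h_0: "h 0 = \<one>\<^bsub>H\<^esub>"
    and h_two: "\<And>x. x \<in> carrier H \<Longrightarrow> card {i. i < 2 * m \<and> h i = x} = 2"
    and q_two: "\<And>x. x \<in> carrier H \<Longrightarrow> card {i. i < 2 * m \<and> quotients H h i = x} = 2"
    using D by (simp_all add: D_sequence_def m_def)
  have q_carr: "quotients H h i \<in> carrier H" if "i < 2 * m" for i
    using h_carr that by (auto simp: quotients_def)
  have k: "int k > 0" "4 dvd int k" using assms(3,4) by auto
  have "card (carrier H) = m" by (simp add: m_def order_def)
  obtain C where C: "C 0 0 = 0" "C (2 * m - 1) (int k - 1) = 0"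
    and C_hits: "\<And>i y. i < 2 * m \<Longrightarrow> hits (int k) (C i) y = 1"
    and C_step: "\<And>x y. x \<in> carrier H \<Longrightarrow>
       (\<Sum>i | i < 2 * m \<and> quotients H h i = x. hits (int k) (column_step (2 * m) (int k) C i) y) = 2"
    using lifting_columns[OF k \<open>m > 0\<close> assms(2) \<open>card (carrier H) = m\<close> q_carr q_two] by blast
  define g where
    "g j = (h (j mod (2 * m)), C (j mod (2 * m)) (int (j div (2 * m))) mod int k)" for j
  have carr_K: "carrier (integer_mod_group k) = {0..<int k}"
    using \<open>k > 0\<close> by (simp add: carrier_integer_mod_group)
  have order_K: "order (integer_mod_group k) = k"
    by (simp add: order_def carr_K)
  have order_G: "2 * order (H \<times>\<times> integer_mod_group k) = 2 * m * k"
    by (simp add: order_def carr_K m_def card_cartesian_product)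
  have g_two: "card {j. j < 2 * m * k \<and> g j = (x, y)} = 2"
    if "x \<in> carrier H" "y \<in> {0..<int k}" for x y
  proof -
    have "card {j. j < 2 * m * k \<and> g j = (x, y)}
        = (\<Sum>i | i < 2 * m \<and> h i = x. hits (int k) (C i) y)"
      unfolding g_def by (rule card_row_major_entries[OF l that(2)])
    also have "\<dots> = (\<Sum>i | i < 2 * m \<and> h i = x. 1)"
      by (intro sum.cong) (auto simp: C_hits)
    also have "\<dots> = 2" using h_two[OF that(1)] by simp
    finally show ?thesis .
  qed
  have quot: "quotients (H \<times>\<times> integer_mod_group k) g j = (quotients H h (j mod (2 * m)),
      column_step (2 * m) (int k) C (j mod (2 * m)) (int (j div (2 * m))) mod int k)"
    if "j < 2 * m * k" for j
    by (rule quotients_row_major[OF assms(1,3) l h_carr h_0 h_last C g_def that])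
  have quot_two: "card {j. j < 2 * m * k \<and> quotients (H \<times>\<times> integer_mod_group k) g j = (x, y)} = 2"
    if "x \<in> carrier H" "y \<in> {0..<int k}" for x y
  proof -
    have "card {j. j < 2 * m * k \<and> quotients (H \<times>\<times> integer_mod_group k) g j = (x, y)}
        = card {j. j < 2 * m * k \<and> (quotients H h (j mod (2 * m)),
            column_step (2 * m) (int k) C (j mod (2 * m)) (int (j div (2 * m))) mod int k) = (x, y)}"
      by (simp only: quot cong: conj_cong)
    also have "\<dots> = (\<Sum>i | i < 2 * m \<and> quotients H h i = x.
        hits (int k) (column_step (2 * m) (int k) C i) y)"
      by (rule card_row_major_entries[OF l that(2)])
    also have "\<dots> = 2" by (rule C_step[OF that(1)])
    finally show ?thesis .
  qed
  have "D_sequence (H \<times>\<times> integer_mod_group k) g"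
    unfolding D_sequence_def order_G
  proof (intro conjI allI impI ballI)
    show "g j \<in> carrier (H \<times>\<times> integer_mod_group k)" for j
      using h_carr[of "j mod (2 * m)"] \<open>m > 0\<close> \<open>k > 0\<close> by (simp add: g_def carr_K)
    show "g 0 = \<one>\<^bsub>H \<times>\<times> integer_mod_group k\<^esub>"
      using h_0 C(1) by (simp add: g_def)
  qed (use g_two quot_two carr_K in auto)
  moreover have "g (2 * m * k - 1) = \<one>\<^bsub>H \<times>\<times> integer_mod_group k\<^esub>"
  proof -
    have "2 * m * k - 1 = (2 * m - 1) + 2 * m * (k - 1)"
      using \<open>m > 0\<close> \<open>k > 0\<close> by (cases k) auto
    then have "(2 * m * k - 1) mod (2 * m) = 2 * m - 1" "(2 * m * k - 1) div (2 * m) = k - 1"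
      using row_major_position[of "2 * m - 1" "2 * m" "k - 1"] l by simp_all
    then show ?thesis
      using h_last C(2) \<open>k > 0\<close> by (simp add: g_def of_nat_diff)
  qed
  moreover have "fst (g (i + 2 * t * order H)) = h i" if "i < 2 * order H" for i t
    using that by (simp add: g_def m_def mult.assoc mult.left_commute)
  ultimately show ?thesis
    using D by (auto simp: is_lift_def cyclic_D_sequence_def order_G)
qed

theorem lemma16:
  fixes H :: "('a, 'b) monoid_scheme" and n :: nat and h :: "nat \<Rightarrow> 'a"
  assumes "group H" and "finite (carrier H)"
    and "n \<ge> 2"
    and "cyclic_D_sequence H h"
  shows "\<exists>g. is_lift H (integer_mod_group (2 ^ n)) h g \<and>
             cyclic_D_sequence (H \<times>\<times> integer_mod_group (2 ^ n)) g"
proof (rule cyclic_D_sequence_lift_mod_multiple_of_4)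
  show "4 dvd (2 :: nat) ^ n"
    using le_imp_power_dvd[OF assms(3), of "2 :: nat"] by simp
qed (use assms in auto)

end
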